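(* For every $w\in\{L,R\}^\star$, $$2-\left(\tfrac12\right)^{\ell(w)}\le D^2[P_w]\le \frac{2\ell(w)}{3}+\frac89+\frac{(-1)^{\ell(w)}}{9\cdot 2^{\ell(w)}},$$ and for every nonempty $w\in\{L,R\}^\star$, $$\frac{2\ell_b(w)}{3}+\frac89+\frac{(-1)^{\ell_b(w)}}{9\cdot 2^{\ell_b(w)}}\le D^2[P_w]<2\,\ell_b(w).$$ None of these inequalities can be improved: the first lower bound is attained by the constant words $L^n$ and $R^n$, the first upper bound and the second lower bound are attained by the alternating words, and, for every $k\ge1$ and every alternating word $v=v_1\dots v_k$ of length $k$, $$\sup\{D^2[P_w]: w\in\{L,R\}^\star,\ \ell_b(w)=k\}=\lim_{n\to\infty}D^2[P_{v_1^nv_2^n\cdots v_k^n}]=2k.$$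
   Context: $\{L,R\}^\star$ is the set of all finite words in the letters $L,R$, including the empty word $\varepsilon$; $\ell(w)$ is the length of $w$. For a nonempty word written as $w=u_1^{n_1}u_2^{n_2}\cdots u_k^{n_k}$ with $u_i\in\{L,R\}$, $u_i\ne u_{i+1}$, $n_i>0$ (where $u^n$ is the letter $u$ repeated $n$ times), the number of blocks is $\ell_b(w)=k$. A word $v_1\dots v_n$ is alternating if $v_{i-1}\neq v_i$ for $1<i\le n$ (the empty word is regarded as alternating of length $0$). For probability measures $\mu,\nu$ on $\mathbb{Z}$ with mean zero, $\Phi(\mu,\nu)(d)=\frac12\mu(d+1)+\frac12\nu(d-1)$, $\Phi_L(\mu,\nu)=(\Phi(\mu,\nu),\nu)$, $\Phi_R(\mu,\nu)=(\mu,\Phi(\mu,\nu))$. For a word $w=w_1\dots w_n$ put $P_w=\Phi\circ\Phi_{w_n}\circ\cdots\circ\Phi_{w_1}(\delta_0,\delta_0)$, with $P_\varepsilon=\Phi(\delta_0,\delta_0)=\frac12\delta_{-1}+\frac12\delta_1$. $D^2[P]$ denotes the variance of the probability measure $P$. *)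

theory Defs
  imports "HOL-Probability.Probability"
begin

datatype letter = L | R

text \<open>
  \<open>\<Phi>(\<mu>, \<nu>)\<close> is the fair mixture of \<open>\<mu>\<close> shifted by \<open>-1\<close> and \<open>\<nu>\<close> shifted by \<open>+1\<close>; its mass
  function is given in \<open>pmf_Phi\<close> below. It is defined here for all probability measures on the
  integers; the mean-zero ones form a subclass that it preserves, and only finitely supported
  ones arise in \<open>P\<close> (see \<open>finite_set_pmf_P\<close>).
\<close>

definition Phi :: "int pmf \<times> int pmf \<Rightarrow> int pmf" where
  "Phi = (\<lambda>(\<mu>, \<nu>). bernoulli_pmf (1/2) \<bind>
     (\<lambda>b. if b then map_pmf (\<lambda>x. x - 1) \<mu> else map_pmf (\<lambda>x. x + 1) \<nu>))"

lemma pmf_Phi: "pmf (Phi (\<mu>, \<nu>)) d = 1/2 * pmf \<mu> (d + 1) + 1/2 * pmf \<nu> (d - 1)"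
proof -
  have "pmf (map_pmf (\<lambda>x::int. x - 1) \<mu>) ((d + 1) - 1) = pmf \<mu> (d + 1)"
    by (intro pmf_map_inj') (simp add: inj_on_def)
  moreover have "pmf (map_pmf (\<lambda>x::int. x + 1) \<nu>) ((d - 1) + 1) = pmf \<nu> (d - 1)"
    by (intro pmf_map_inj') (simp add: inj_on_def)
  ultimately show ?thesis
    by (simp add: Phi_def pmf_bind)
qed

fun Phi_letter :: "letter \<Rightarrow> int pmf \<times> int pmf \<Rightarrow> int pmf \<times> int pmf" where
  "Phi_letter L (\<mu>, \<nu>) = (Phi (\<mu>, \<nu>), \<nu>)"
| "Phi_letter R (\<mu>, \<nu>) = (\<mu>, Phi (\<mu>, \<nu>))"

text \<open>The first letter of the word acts first.\<close>

definition P :: "letter list \<Rightarrow> int pmf" where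
  "P w = Phi (fold Phi_letter w (return_pmf 0, return_pmf 0))"

lemma finite_set_pmf_P: "finite (set_pmf (P w))"
proof -
  have Phi: "finite (set_pmf (Phi (\<mu>, \<nu>)))" if "finite (set_pmf \<mu>)" "finite (set_pmf \<nu>)" for \<mu> \<nu>
    using that by (auto simp: Phi_def)
  have "finite (set_pmf (Phi (fold Phi_letter w (\<mu>, \<nu>))))"
    if "finite (set_pmf \<mu>)" "finite (set_pmf \<nu>)" for \<mu> \<nu>
    using that
  proof (induction w arbitrary: \<mu> \<nu>)
    case (Cons a w)
    then show ?case by (cases a) (simp_all add: Phi)
  qed (simp add: Phi)
  then show ?thesis by (simp add: P_def)
qed

definition D2 :: "int pmf \<Rightarrow> real" where
  "D2 p = measure_pmf.variance p real_of_int"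

text \<open>
  \<open>remdups_adj\<close> sends \<open>u\<^sub>1^n\<^sub>1 \<dots> u\<^sub>k^n\<^sub>k\<close> to \<open>u\<^sub>1 \<dots> u\<^sub>k\<close>; the two lemmas below state that the
  block decomposition exists and that \<open>num_blocks\<close> is its number of blocks.
\<close>

definition num_blocks :: "letter list \<Rightarrow> nat" where
  "num_blocks w = length (remdups_adj w)"

definition block_decomposition :: "(letter \<times> nat) list \<Rightarrow> letter list \<Rightarrow> bool" where
  "block_decomposition bs w \<longleftrightarrow>
     w = concat (map (\<lambda>(u, n). replicate n u) bs) \<and>
     (\<forall>(u, n) \<in> set bs. 0 < n) \<and> distinct_adj (map fst bs)"

lemma remdups_adj_replicate_append:
  "0 < n \<Longrightarrow> remdups_adj (replicate n u @ w) = remdups_adj (u # w)"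
proof (induction n)
  case (Suc n)
  then show ?case by (cases n) auto
qed simp

lemma num_blocks_eqI:
  assumes "block_decomposition bs w"
  shows "num_blocks w = length bs"
proof -
  have "remdups_adj (concat (map (\<lambda>(u, n). replicate n u) bs)) = map fst bs"
    if "\<forall>(u, n) \<in> set bs. 0 < n" "distinct_adj (map fst bs)"
    using that
  proof (induction bs)
    case (Cons b bs)
    obtain u n where b: "b = (u, n)" by (cases b)
    have IH: "remdups_adj (concat (map (\<lambda>(u, n). replicate n u) bs)) = map fst bs"
      using Cons by (auto simp: distinct_adj_Cons)
    have n: "0 < n" using Cons.prems b by auto
    show ?case
    proof (cases bs)
      case Nil
      then show ?thesis using remdups_adj_replicate_append[OF n, of u "[]"] by (simp add: b)
    next
      case (Cons c cs)
      obtain v m where c: "c = (v, m)" by (cases c)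
      from Cons.prems Cons b c have "u \<noteq> v" "0 < m" by auto
      then obtain m' where "m = Suc m'" by (cases m) auto
      with IH \<open>u \<noteq> v\<close> show ?thesis
        by (simp add: b c Cons remdups_adj_replicate_append[OF n])
    qed
  qed simp
  with assms show ?thesis
    unfolding num_blocks_def block_decomposition_def by (metis length_map)
qed

lemma ex_block_decomposition: "\<exists>bs. block_decomposition bs w"
proof (induction w)
  case Nil
  show ?case by (rule exI[of _ "[]"]) (simp add: block_decomposition_def)
next
  case (Cons x w)
  then obtain bs where bs: "block_decomposition bs w" by blast
  show ?case
  proof (cases "bs \<noteq> [] \<and> fst (hd bs) = x")
    case True
    then obtain n bs' where "bs = (x, n) # bs'" by (cases bs) auto
    with bs have "block_decomposition ((x, Suc n) # bs') (x # w)"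
      by (auto simp: block_decomposition_def)
    then show ?thesis by blast
  next
    case False
    with bs have "block_decomposition ((x, 1) # bs) (x # w)"
      by (cases bs) (auto simp: block_decomposition_def)
    then show ?thesis by blast
  qed
qed

end

theory Submission
  imports Defs
begin

text \<open>
  All measures involved have mean zero, so \<open>D2 (Phi (\<mu>, \<nu>))\<close> is \<open>s = (a + b) / 2 + 1\<close>, where \<open>a\<close> and
  \<open>b\<close> are the second moments of \<open>\<mu>\<close> and \<open>\<nu>\<close>. The gaps \<open>s - a\<close> and \<open>s - b\<close> add up to \<open>2\<close>; a letter
  halves its own gap and increases \<open>s\<close> by the same amount. If \<open>z\<close> is the gap of the letter not used
  last, then repeating the last letter replaces \<open>(s, z)\<close> by \<open>(s + 1 - z / 2, 1 + z / 2)\<close> and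
  switching replaces it by \<open>(s + z / 2, 2 - z / 2)\<close>. The four bounds follow by induction on
  the word from bounds on the total increase that are affine in \<open>z\<close>.
\<close>

section \<open>Second moments of centred measures\<close>

lemma expectation_Phi:
  fixes f :: "int \<Rightarrow> real"
  assumes "finite (set_pmf \<mu>)" "finite (set_pmf \<nu>)"
  shows "measure_pmf.expectation (Phi (\<mu>, \<nu>)) f =
    (measure_pmf.expectation \<mu> (\<lambda>x. f (x - 1)) + measure_pmf.expectation \<nu> (\<lambda>x. f (x + 1))) / 2"
  unfolding Phi_def prod.case
  by (subst pmf_expectation_bind[where A = UNIV])
     (use assms in \<open>auto simp: UNIV_bool add_divide_distrib\<close>)

lemma finite_set_pmf_Phi:
  "finite (set_pmf \<mu>) \<Longrightarrow> finite (set_pmf \<nu>) \<Longrightarrow> finite (set_pmf (Phi (\<mu>, \<nu>)))"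
  by (auto simp: Phi_def)

definition centred :: "int pmf \<Rightarrow> bool" where
  "centred p \<longleftrightarrow> finite (set_pmf p) \<and> measure_pmf.expectation p real_of_int = 0"

lemma D2_centred: "centred p \<Longrightarrow> D2 p = measure_pmf.expectation p (\<lambda>x. (real_of_int x)\<^sup>2)"
  by (simp add: D2_def centred_def)

lemma centred_Phi:
  assumes "centred \<mu>" "centred \<nu>"
  shows "centred (Phi (\<mu>, \<nu>))" and "D2 (Phi (\<mu>, \<nu>)) = (D2 \<mu> + D2 \<nu>) / 2 + 1"
proof -
  have fin: "finite (set_pmf \<mu>)" "finite (set_pmf \<nu>)"
    and mean: "measure_pmf.expectation \<mu> real_of_int = 0" "measure_pmf.expectation \<nu> real_of_int = 0"
    using assms by (auto simp: centred_def)
  have [simp]: "integrable (measure_pmf \<mu>) f" "integrable (measure_pmf \<nu>) f" for f :: "int \<Rightarrow> real"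
    using fin by (auto intro: integrable_measure_pmf_finite)
  show c: "centred (Phi (\<mu>, \<nu>))"
    using fin mean by (simp add: centred_def finite_set_pmf_Phi expectation_Phi)
  show "D2 (Phi (\<mu>, \<nu>)) = (D2 \<mu> + D2 \<nu>) / 2 + 1"
    using fin mean
    by (simp add: D2_centred[OF c] D2_centred[OF assms(1)] D2_centred[OF assms(2)]
        expectation_Phi power2_sum power2_diff add_divide_distrib)
qed

section \<open>Reduction to a recursion on gaps\<close>

text \<open>The increase of \<open>s\<close> along a word, from a state with last letter \<open>u\<close> and gap \<open>z\<close> of the other letter.\<close>

fun gain :: "letter \<Rightarrow> real \<Rightarrow> letter list \<Rightarrow> real" where
  "gain u z [] = 0"
| "gain u z (v # w) =
    (if v = u then (1 - z / 2) + gain u (1 + z / 2) w else z / 2 + gain v (2 - z / 2) w)"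

text \<open>Since the two gaps add up to \<open>2\<close>, taking the other letter as the last one
  replaces \<open>z\<close> by \<open>2 - z\<close>.\<close>

lemma gain_swap:
  assumes "u \<noteq> v"
  shows "gain u z w = gain v (2 - z) w"
proof (cases w)
  case (Cons c w')
  have "c = u \<or> c = v"
    using assms by (cases c; cases u; cases v) auto
  with assms Cons show ?thesis by (auto simp: diff_divide_distrib)
qed simp

text \<open>The argument of \<open>gain\<close> is the gap of \<open>R\<close>, so \<open>L\<close>
  is treated as the last letter throughout; after an actual \<open>R\<close>,
  \<open>gain_swap\<close> restores this convention.\<close>

lemma D2_fold_Phi_letter:
  assumes "centred \<mu>" "centred \<nu>"
  shows "D2 (Phi (fold Phi_letter w (\<mu>, \<nu>))) =
    D2 (Phi (\<mu>, \<nu>)) + gain L (D2 (Phi (\<mu>, \<nu>)) - D2 \<nu>) w"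
  using assms
proof (induction w arbitrary: \<mu> \<nu>)
  case (Cons c w)
  let ?s = "D2 (Phi (\<mu>, \<nu>))"
  have s: "?s = (D2 \<mu> + D2 \<nu>) / 2 + 1" and cen: "centred (Phi (\<mu>, \<nu>))"
    using centred_Phi Cons.prems by auto
  show ?case
  proof (cases c)
    case L
    have "D2 (Phi (Phi (\<mu>, \<nu>), \<nu>)) = ?s + (1 - (?s - D2 \<nu>) / 2)"
      using centred_Phi(2)[OF cen Cons.prems(2)] by (simp add: field_simps)
    moreover have "D2 (Phi (Phi (\<mu>, \<nu>), \<nu>)) - D2 \<nu> = 1 + (?s - D2 \<nu>) / 2"
      unfolding calculation by (simp add: field_simps)
    ultimately show ?thesis
      using Cons.IH[OF cen Cons.prems(2)] L
      by (simp only: fold_Cons o_apply Phi_letter.simps gain.simps if_True refl add.assoc)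
  next
    case R
    have "D2 (Phi (\<mu>, Phi (\<mu>, \<nu>))) = ?s + (?s - D2 \<nu>) / 2"
      using centred_Phi(2)[OF Cons.prems(1) cen] s by (simp add: field_simps)
    then show ?thesis
      using Cons.IH[OF Cons.prems(1) cen] R
        gain_swap[of R L "2 - (?s - D2 \<nu>) / 2"] by simp
  qed
qed simp

text \<open>In the initial state both gaps are \<open>1\<close>, so any letter can be taken as the last one.\<close>

lemma D2_P: "D2 (P w) = 1 + gain u 1 w"
proof -
  have c: "centred (return_pmf 0)" by (simp add: centred_def)
  then have "D2 (return_pmf 0) = 0" by (simp add: D2_centred)
  then have "D2 (P w) = 1 + gain L 1 w"
    using D2_fold_Phi_letter[OF c c] centred_Phi(2)[OF c c] by (simp add: P_def)
  moreover have "gain L 1 w = gain u 1 w"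
    using gain_swap[of L u 1 w] by (cases "u = L") auto
  ultimately show ?thesis by simp
qed

section \<open>Affine bounds on the gain\<close>

text \<open>The solution of the recursion for \<open>gain\<close> along \<open>m\<close> switches.\<close>

definition alt_gain :: "nat \<Rightarrow> real \<Rightarrow> real" where
  "alt_gain m z = (1 - (-1/2) ^ m) / 3 * z + (2 * real m / 3 - 4/9 + 4/9 * (-1/2) ^ m)"

lemma alt_gain_0 [simp]: "alt_gain 0 z = 0"
  by (simp add: alt_gain_def)

lemma alt_gain_Suc: "alt_gain (Suc m) z = z / 2 + alt_gain m (2 - z / 2)"
  by (simp add: alt_gain_def field_simps)

lemma alt_gain_diff: "alt_gain m z - alt_gain m z' = (1 - (-1/2) ^ m) / 3 * (z - z')"
  by (simp add: alt_gain_def field_simps)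

lemma alt_gain_slope: "0 \<le> (1 - (-1/2) ^ m) / (3::real)" "(1 - (-1/2) ^ m) / (3::real) \<le> 1"
proof -
  have "\<bar>(-1/2) ^ m :: real\<bar> \<le> 1" unfolding power_abs by (simp add: power_le_one)
  then have "(-1/2) ^ m \<le> (1::real)" "- ((-1/2) ^ m) \<le> (1::real)" by linarith+
  then show "0 \<le> (1 - (-1/2) ^ m) / (3::real)" "(1 - (-1/2) ^ m) / (3::real) \<le> 1" by auto
qed

lemma alt_gain_1: "1 + alt_gain m 1 = 2 * real m / 3 + 8/9 + (-1) ^ m / (9 * 2 ^ m)"
  unfolding alt_gain_def power_divide by (simp add: field_simps)

text \<open>Switching gains \<open>z - 1\<close> more at once than repeating but leaves a gap
  smaller by \<open>z - 1\<close>. As \<open>alt_gain\<close> has slope at most \<open>1\<close> in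
  the gap, repeating cannot make up the difference.\<close>

lemma gain_le_alt_gain:
  assumes "1 \<le> z" "z \<le> 2"
  shows "gain u z w \<le> alt_gain (length w) z"
  using assms
proof (induction w arbitrary: u z)
  case (Cons c w)
  let ?m = "length w"
  have "gain u (1 + z / 2) w \<le> alt_gain ?m (1 + z / 2)" "gain c (2 - z / 2) w \<le> alt_gain ?m (2 - z / 2)"
    using Cons by auto
  moreover have "alt_gain ?m (1 + z / 2) - alt_gain ?m (2 - z / 2) \<le> z - 1"
    using alt_gain_slope[of ?m] Cons.prems mult_right_mono[of "(1 - (-1/2) ^ ?m) / 3" 1 "z - 1"]
    by (simp add: alt_gain_diff)
  ultimately show ?case by (auto simp: alt_gain_Suc)
qed simp

text \<open>The bound is the gain from repeating \<open>u\<close> throughout, which halves the gap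
  \<open>2 - z\<close> each time. Since \<open>1 - z / 2 \<le> z / 2\<close>, a switch does at least
  as well, both at once and in the bound for the rest.\<close>

lemma gain_ge_const:
  assumes "1 \<le> z" "z \<le> 2"
  shows "(2 - z) * (1 - (1/2) ^ length w) \<le> gain u z w"
  using assms
proof (induction w arbitrary: u z)
  case (Cons c w)
  let ?q = "(1/2) ^ length w :: real"
  have q: "0 \<le> ?q" "?q \<le> 1" by (auto simp: power_le_one)
  have "(1 - z / 2) * (1 - ?q) \<le> gain u (1 + z / 2) w" "(z / 2) * (1 - ?q) \<le> gain c (2 - z / 2) w"
    using Cons.IH[of "1 + z / 2" u] Cons.IH[of "2 - z / 2" c] Cons.prems by auto
  moreover have "(1 - z / 2) * (1 - ?q) \<le> (z / 2) * (1 - ?q)"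
    using Cons.prems q by (intro mult_right_mono) auto
  moreover have "(2 - z) * (1 - (1/2) ^ length (c # w)) = (1 - z / 2) + (1 - z / 2) * (1 - ?q)"
    by (simp add: field_simps)
  ultimately show ?case using Cons.prems by auto
qed simp

lemma num_blocks_Cons_Cons:
  "num_blocks (u # v # w) = (if u = v then num_blocks (v # w) else Suc (num_blocks (v # w)))"
  by (simp add: num_blocks_def)

lemma gain_ge_alt_gain:
  assumes "1 \<le> z" "z \<le> 2" "num_blocks (u # w) = Suc m"
  shows "alt_gain m z \<le> gain u z w"
  using assms
proof (induction w arbitrary: u z m)
  case Nil
  then show ?case by (simp add: num_blocks_def)
next
  case (Cons c w)
  show ?case
  proof (cases "c = u")
    case True
    then have "alt_gain m (1 + z / 2) \<le> gain u (1 + z / 2) w"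
      using Cons by (auto simp: num_blocks_Cons_Cons)
    moreover have "0 \<le> alt_gain m (1 + z / 2) - alt_gain m z"
      unfolding alt_gain_diff using alt_gain_slope[of m] Cons.prems
      by (intro mult_nonneg_nonneg) auto
    ultimately show ?thesis using True Cons.prems by simp
  next
    case False
    then have nb: "num_blocks (c # w) = m"
      using Cons.prems by (simp add: num_blocks_Cons_Cons)
    then obtain m' where "m = Suc m'"
      by (cases m) (auto simp: num_blocks_def)
    then show ?thesis
      using False Cons.IH[of "2 - z / 2" c m'] nb Cons.prems by (auto simp: alt_gain_Suc)
  qed
qed

text \<open>A repetition lowers the right-hand side by exactly its gain. A switch lowers it by
  \<open>4 - 2 * z\<close> more than its gain, which is positive as \<open>z < 2\<close>.\<close>

lemma gain_less:
  assumes "1 \<le> z" "z < 2"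
  shows "gain u z w < 2 * real (num_blocks (u # w)) - z"
  using assms
proof (induction w arbitrary: u z)
  case Nil
  then show ?case by (simp add: num_blocks_def)
next
  case (Cons c w)
  show ?case
    using Cons.prems Cons.IH[of "1 + z / 2" u] Cons.IH[of "2 - z / 2" c] by (auto simp: num_blocks_Cons_Cons)
qed

section \<open>Words with long blocks\<close>

lemma gain_replicate_append:
  "gain u z (replicate n u @ w) = (2 - z) * (1 - (1/2) ^ n) + gain u (2 - (2 - z) * (1/2) ^ n) w"
proof (induction n arbitrary: z)
  case (Suc n)
  have "2 - (1 + z / 2) = (2 - z) / 2" by (simp add: field_simps)
  with Suc[of "1 + z / 2"] show ?case by (simp add: field_simps)
qed simp

text \<open>A long block uses up the gap of its letter, driving the other gap to \<open>2\<close>,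
  so the next block again gains almost \<open>2\<close>. The gap before a block depends on
  \<open>n\<close>, hence the sequence \<open>Z\<close>.\<close>

lemma tendsto_gain_blocks:
  assumes "distinct_adj (u # v)" "Z \<longlonglongrightarrow> 2"
  shows "(\<lambda>n. gain u (Z n) (concat (map (replicate n) v))) \<longlonglongrightarrow> 2 * real (length v)"
  using assms
proof (induction v arbitrary: u Z)
  case (Cons a v)
  have half: "(\<lambda>n. (1/2) ^ n :: real) \<longlonglongrightarrow> 0" by (rule LIMSEQ_power_zero) simp
  have "(\<lambda>n. 2 - Z n * (1/2) ^ n) \<longlonglongrightarrow> 2 - 2 * 0" "(\<lambda>n. Z n * (1 - (1/2) ^ n)) \<longlonglongrightarrow> 2 * (1 - 0)"
    by (intro tendsto_intros Cons.prems half)+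
  then have "(\<lambda>n. Z n * (1 - (1/2) ^ n) + gain a (2 - Z n * (1/2) ^ n) (concat (map (replicate n) v)))
      \<longlonglongrightarrow> 2 * (1 - 0) + 2 * real (length v)"
    using Cons.prems by (intro tendsto_add Cons.IH) (auto simp: distinct_adj_Cons)
  moreover have "u \<noteq> a" using Cons.prems by simp
  ultimately show ?case by (simp add: gain_swap[of u a] gain_replicate_append algebra_simps)
qed simp

lemma tendsto_D2_blocks:
  assumes "distinct_adj v" "v \<noteq> []"
  shows "(\<lambda>n. D2 (P (concat (map (replicate n) v)))) \<longlonglongrightarrow> 2 * real (length v)"
proof -
  obtain a v' where v: "v = a # v'" using assms by (cases v) auto
  have half: "(\<lambda>n. (1/2) ^ n :: real) \<longlonglongrightarrow> 0" by (rule LIMSEQ_power_zero) simp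
  \<comment> \<open>The same sequence plays two roles: the variance after the first block, and the
    gap of the other letter at that point.\<close>
  have "(\<lambda>n. 2 - (1/2) ^ n :: real) \<longlonglongrightarrow> 2 - 0" "(\<lambda>n. 2 - (1/2) ^ n :: real) \<longlonglongrightarrow> 2 - 0"
    by (intro tendsto_intros half)+
  then have "(\<lambda>n. (2 - (1/2) ^ n) + gain a (2 - (1/2) ^ n) (concat (map (replicate n) v')))
      \<longlonglongrightarrow> (2 - 0) + 2 * real (length v')"
    using assms v by (intro tendsto_add tendsto_gain_blocks) auto
  then show ?thesis by (simp add: v D2_P[of _ a] gain_replicate_append algebra_simps)
qed

lemma num_blocks_distinct_adj: "distinct_adj w \<Longrightarrow> num_blocks w = length w"
  using num_blocks_eqI[of "map (\<lambda>u. (u, 1)) w" w]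
  by (auto simp: block_decomposition_def o_def concat_map_singleton)

lemma num_blocks_concat_replicate:
  assumes "distinct_adj v" "0 < n"
  shows "num_blocks (concat (map (replicate n) v)) = length v"
proof -
  have "block_decomposition (map (\<lambda>u. (u, n)) v) (concat (map (replicate n) v))"
    using assms by (auto simp: block_decomposition_def o_def)
  from num_blocks_eqI[OF this] show ?thesis by simp
qed

section \<open>Bounds on the variance and their sharpness\<close>

lemma D2_P_bounds_length:
  "2 - (1/2) ^ length w \<le> D2 (P w)"
  "D2 (P w) \<le> 2 * real (length w) / 3 + 8/9 + (-1) ^ length w / (9 * 2 ^ length w)"
  using gain_ge_const[of 1 w L] gain_le_alt_gain[of 1 L w]
  by (simp_all add: D2_P[of _ L] flip: alt_gain_1)

lemma D2_P_bounds_num_blocks: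
  assumes "w \<noteq> []"
  shows "2 * real (num_blocks w) / 3 + 8/9 + (-1) ^ num_blocks w / (9 * 2 ^ num_blocks w) \<le> D2 (P w)"
    and "D2 (P w) < 2 * real (num_blocks w)"
proof -
  obtain a w' where w: "w = a # w'" using assms by (cases w) auto
  \<comment> \<open>With \<open>u\<close> as the initial last letter, the first letter of
    \<open>w\<close> is already a switch, so \<open>w\<close> has \<open>num_blocks w\<close>
    switches.\<close>
  obtain u where u: "u \<noteq> a" by (cases a) auto
  show "2 * real (num_blocks w) / 3 + 8/9 + (-1) ^ num_blocks w / (9 * 2 ^ num_blocks w) \<le> D2 (P w)"
    using gain_ge_alt_gain[of 1 u w "num_blocks w"] u
    by (simp add: D2_P[of _ u] w num_blocks_Cons_Cons flip: alt_gain_1)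
  show "D2 (P w) < 2 * real (num_blocks w)"
    using gain_less[of 1 a w] by (simp add: D2_P[of _ a] w num_blocks_Cons_Cons)
qed

text \<open>For a nonempty alternating word the number of blocks is the length, so the upper bound
  by length and the lower bound by blocks coincide.\<close>

lemma D2_P_distinct_adj:
  assumes "distinct_adj w"
  shows "D2 (P w) = 2 * real (length w) / 3 + 8/9 + (-1) ^ length w / (9 * 2 ^ length w)"
proof (cases "w = []")
  case True
  then show ?thesis by (simp add: D2_P[of _ L])
next
  case False
  moreover have "num_blocks w = length w" using assms by (rule num_blocks_distinct_adj)
  ultimately show ?thesis
    using D2_P_bounds_length(2)[of w] D2_P_bounds_num_blocks(1)[of w] by simp
qed

lemma D2_P_replicate: "D2 (P (replicate n u)) = 2 - (1/2) ^ n"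
  using gain_replicate_append[of u 1 n "[]"] by (simp add: D2_P[of _ u])

lemma Sup_D2_P:
  fixes v :: "letter list"
  assumes "distinct_adj v" "v \<noteq> []"
  shows "Sup {D2 (P w) | w. num_blocks w = length v} = 2 * real (length v)"
proof (rule cSup_eq_non_empty)
  let ?S = "{D2 (P w) | w. num_blocks w = length v}"
  have mem: "D2 (P (concat (map (replicate n) v))) \<in> ?S" if "0 < n" for n
    using num_blocks_concat_replicate[OF assms(1) that] by auto
  from mem[of 1] show "?S \<noteq> {}" by (metis empty_iff zero_less_one)
  show "x \<le> 2 * real (length v)" if x: "x \<in> ?S" for x
  proof -
    from x obtain w where w: "x = D2 (P w)" "num_blocks w = length v" by auto
    have "w \<noteq> []" using assms(2) w(2) by (auto simp: num_blocks_def)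
    from D2_P_bounds_num_blocks(2)[OF this] w show ?thesis by simp
  qed
  show "2 * real (length v) \<le> y" if upper: "\<And>x. x \<in> ?S \<Longrightarrow> x \<le> y" for y
  proof (rule LIMSEQ_le_const2[OF tendsto_D2_blocks[OF assms]])
    \<comment> \<open>The threshold is \<open>1\<close>, since for \<open>n = 0\<close> the word is
      empty and has no blocks.\<close>
    show "\<exists>N. \<forall>n\<ge>N. D2 (P (concat (map (replicate n) v))) \<le> y"
      by (intro exI[of _ 1] allI impI upper mem) simp
  qed
qed

theorem theorem19:
  "(\<forall>w. 2 - (1/2) ^ length w \<le> D2 (P w) \<and>
        D2 (P w) \<le> 2 * real (length w) / 3 + 8/9 + (-1) ^ length w / (9 * 2 ^ length w)) \<and>
   (\<forall>w. w \<noteq> [] \<longrightarrow>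
        2 * real (num_blocks w) / 3 + 8/9 + (-1) ^ num_blocks w / (9 * 2 ^ num_blocks w) \<le> D2 (P w) \<and>
        D2 (P w) < 2 * real (num_blocks w)) \<and>
   (\<forall>u n. D2 (P (replicate n u)) = 2 - (1/2) ^ length (replicate n u)) \<and>
   (\<forall>w. distinct_adj w \<longrightarrow>
        D2 (P w) = 2 * real (length w) / 3 + 8/9 + (-1) ^ length w / (9 * 2 ^ length w)) \<and>
   (\<forall>w. distinct_adj w \<and> w \<noteq> [] \<longrightarrow>
        D2 (P w) = 2 * real (num_blocks w) / 3 + 8/9 + (-1) ^ num_blocks w / (9 * 2 ^ num_blocks w)) \<and>
   (\<forall>k v. 1 \<le> k \<and> distinct_adj v \<and> length v = k \<longrightarrow>
        Sup {D2 (P w) | w. num_blocks w = k} = 2 * real k \<and>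
        (\<lambda>n. D2 (P (concat (map (replicate n) v)))) \<longlonglongrightarrow> 2 * real k)"
proof (intro conjI allI impI)
  fix w :: "letter list"
  assume "distinct_adj w \<and> w \<noteq> []"
  then show "D2 (P w) = 2 * real (num_blocks w) / 3 + 8/9 + (-1) ^ num_blocks w / (9 * 2 ^ num_blocks w)"
    using D2_P_distinct_adj[of w] by (simp add: num_blocks_distinct_adj)
next
  fix k :: nat and v :: "letter list"
  assume "1 \<le> k \<and> distinct_adj v \<and> length v = k"
  then have v: "distinct_adj v" "v \<noteq> []" and k: "k = length v" by auto
  show "Sup {D2 (P w) | w. num_blocks w = k} = 2 * real k"
    unfolding k by (rule Sup_D2_P[OF v])
  show "(\<lambda>n. D2 (P (concat (map (replicate n) v)))) \<longlonglongrightarrow> 2 * real k"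
    unfolding k by (rule tendsto_D2_blocks[OF v])
next
  show "D2 (P (replicate n u)) = 2 - (1/2) ^ length (replicate n u)" for n u
    by (simp add: D2_P_replicate)
qed (fact D2_P_bounds_length D2_P_bounds_num_blocks D2_P_distinct_adj)+

end
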